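(* Let $n\ge3$, let $x\in S^n$ be $\frac12$-integer, and let $\mathcal{P}$ be any partition of the set of $\frac12$-edges of $x$ into pairs. Then $x$ is in the convex hull of incidence vectors of $1$-trees of $K_n$ that each contain exactly one edge from each pair in $\mathcal{P}$.
   Context: $K_n=(V_n,E_n)$ is the complete graph on $n$ nodes, one of which is labelled $1$. For $U\subseteq V_n$, $\delta(U)$ is the set of edges with exactly one endpoint in $U$, $x(F)=\sum_{e\in F}x_e$. $S^n=\{x\in\mathbb{R}^{E_n}: x(\delta(v))=2 \ \forall v,\ x(\delta(S))\ge 2\ \forall \emptyset\ne S\subsetneq V_n,\ 0\le x\le 1\}$. A point $x\in S^n$ is $\frac12$-integer if $x_e\in\{0,\frac12,1\}$ for all $e$; its $\frac12$-edges are the edges with $x_e=\frac12$. A $1$-tree is an edge set $F\subseteq E_n$ with $|F\cap\delta(1)|=2$ such that $F\setminus\delta(1)$ is a spanning tree on $V_n\setminus\{1\}$. *)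

theory Defs
  imports "HOL-Analysis.Analysis"
begin

text \<open>The nodes of \<open>K\<^sub>n\<close> are the elements of a finite type \<open>'v\<close>, so \<open>V\<^sub>n = UNIV\<close> and
  \<open>n = CARD('v)\<close>. Edges are two-element node sets.\<close>

definition K_edges :: "'v::finite set set" where
  "K_edges = {e. card e = 2}"

definition cut :: "'v::finite set \<Rightarrow> 'v set set" where
  "cut U = {e \<in> K_edges. card (e \<inter> U) = 1}"

definition edge_space :: "(real ^ ('v::finite set)) set" where
  "edge_space = {x. \<forall>e. e \<notin> K_edges \<longrightarrow> x $ e = 0}"

text \<open>The space \<open>\<real>\<close> to the power \<open>E\<^sub>n\<close> is rendered as the coordinate subspace \<^const>\<open>edge_space\<close>
  of a Euclidean space whose coordinates are indexed by all node sets.\<close>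

definition edge_sum :: "real ^ ('v::finite set) \<Rightarrow> 'v set set \<Rightarrow> real" where
  "edge_sum x F = (\<Sum>e\<in>F. x $ e)"

definition subtour_polytope :: "(real ^ ('v::finite set)) set" where
  "subtour_polytope = {x \<in> edge_space.
     (\<forall>v. edge_sum x (cut {v}) = 2) \<and>
     (\<forall>S. S \<noteq> {} \<and> S \<subset> UNIV \<longrightarrow> edge_sum x (cut S) \<ge> 2) \<and>
     (\<forall>e\<in>K_edges. 0 \<le> x $ e \<and> x $ e \<le> 1)}"

definition half_integer :: "real ^ ('v::finite set) \<Rightarrow> bool" where
  "half_integer x \<longleftrightarrow> (\<forall>e\<in>K_edges. x $ e \<in> {0, 1/2, 1})"

definition half_edges :: "real ^ ('v::finite set) \<Rightarrow> 'v set set" where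
  "half_edges x = {e \<in> K_edges. x $ e = 1/2}"

definition connected_graph :: "'v set \<Rightarrow> 'v set set \<Rightarrow> bool" where
  "connected_graph W T \<longleftrightarrow> W \<noteq> {} \<and> (\<forall>u\<in>W. \<forall>v\<in>W. (u, v) \<in> {(a, b). {a, b} \<in> T}\<^sup>*)"

definition is_cycle :: "'v set set \<Rightarrow> 'v list \<Rightarrow> bool" where
  "is_cycle T vs \<longleftrightarrow> length vs \<ge> 3 \<and> distinct vs \<and>
     (\<forall>i < length vs. {vs ! i, vs ! ((i + 1) mod length vs)} \<in> T)"

definition spanning_tree_on :: "'v::finite set \<Rightarrow> 'v set set \<Rightarrow> bool" where
  "spanning_tree_on W T \<longleftrightarrow>
     T \<subseteq> {e \<in> K_edges. e \<subseteq> W} \<and> connected_graph W T \<and> \<not> (\<exists>vs. is_cycle T vs)"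

definition one_tree :: "'v::finite \<Rightarrow> 'v set set \<Rightarrow> bool" where
  "one_tree r F \<longleftrightarrow>
     F \<subseteq> K_edges \<and> card (F \<inter> cut {r}) = 2 \<and> spanning_tree_on (UNIV - {r}) (F - cut {r})"

text \<open>The node \<open>r\<close> plays the role of the node labelled \<open>1\<close>.\<close>

definition incidence_vector :: "'v::finite set set \<Rightarrow> real ^ ('v set)" where
  "incidence_vector F = (\<chi> e. if e \<in> F then 1 else 0)"

end

theory Submission
  imports Defs
begin

text \<open>The \<open>1\<close>-trees are the bases of a matroid, and \<open>x\<close> lies in its base polytope because the subtour
  constraints give \<open>x(E(S)) \<le> |S| - 1\<close> for \<open>S\<close> avoiding node \<open>1\<close>. Prescribing the sum on each pair
  and the value of each non-half edge cuts out a polytope whose extreme points are shown to be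
  integral, as in the matroid intersection theorem. At an extreme point \<open>y\<close> the tight sets of the
  rank constraints form a lattice, and \<open>y\<close> has an integral sum on each atom of it. Hence every atom
  and every pair that meets the set \<open>F\<close> of fractional coordinates meets it at least twice, so atoms
  and pairs together give at most \<open>|F|\<close> equations on \<open>\<real>\<close> to the power \<open>F\<close>; since both families of
  equations sum to the same one, they have a common nonzero solution, along which \<open>y\<close> can be moved
  in both directions.\<close>

section \<open>Linear algebra: a vector balanced on the fibres of two maps\<close>

lemma fibres_card_le:
  assumes "finite F" and "\<And>e. e \<in> F \<Longrightarrow> \<exists>e'\<in>F. e' \<noteq> e \<and> a e' = a e"
  shows "2 * card (a ` F) \<le> card F"
proof -
  have "2 \<le> card {e\<in>F. a e = k}" if "k \<in> a ` F" for k
  proof -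
    from that obtain e where e: "e \<in> F" "a e = k" by blast
    with assms(2) obtain e' where "e' \<in> F" "e' \<noteq> e" "a e' = k" by metis
    with e have "{e, e'} \<subseteq> {e\<in>F. a e = k}" "card {e, e'} = 2" by auto
    then show ?thesis using assms(1) card_mono[of "{e\<in>F. a e = k}" "{e, e'}"] by simp
  qed
  then have "(\<Sum>k\<in>a ` F. 2) \<le> (\<Sum>k\<in>a ` F. card {e\<in>F. a e = k})"
    by (rule sum_mono)
  also have "\<dots> = card F"
    using sum.image_gen[OF assms(1), of "\<lambda>_. 1::nat" a] by simp
  finally show ?thesis by simp
qed

text \<open>By \<open>fibres_card_le\<close> each map has at most |F|/2 fibres on \<open>F\<close>,
  and one linear relation links the two families of fibre indicators. They therefore span a space of
  dimension less than |F|, and \<open>z\<close> is a nonzero vector of the coordinate space of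
  \<open>F\<close> orthogonal to all of them.\<close>

lemma exists_balanced_vector:
  fixes a :: "'e::finite \<Rightarrow> 'a" and b :: "'e \<Rightarrow> 'b"
  assumes "F \<noteq> {}"
    and a: "\<And>e. e \<in> F \<Longrightarrow> \<exists>e'\<in>F. e' \<noteq> e \<and> a e' = a e"
    and b: "\<And>e. e \<in> F \<Longrightarrow> \<exists>e'\<in>F. e' \<noteq> e \<and> b e' = b e"
  obtains z :: "real^'e" where "z \<noteq> 0" and "\<And>e. e \<notin> F \<Longrightarrow> z $ e = 0"
    and "\<And>k. sum (($) z) {e\<in>F. a e = k} = 0" and "\<And>k. sum (($) z) {e\<in>F. b e = k} = 0"
proof -
  define T :: "(real^'e) set" where "T = (\<lambda>e. axis e 1) ` F"
  define I :: "'e set \<Rightarrow> real^'e" where "I X = (\<Sum>e\<in>X. axis e 1)" for X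
  define SA where "SA = (\<lambda>k. I {e\<in>F. a e = k}) ` (a ` F)"
  define SB where "SB = (\<lambda>k. I {e\<in>F. b e = k}) ` (b ` F)"
  have fin: "finite F" "finite SA" "finite SB" by (auto simp: SA_def SB_def)
  from \<open>F \<noteq> {}\<close> obtain e0 where e0: "e0 \<in> F" by blast
  define s0 where "s0 = I {e\<in>F. a e = a e0}"
  define SA' where "SA' = (\<lambda>k. I {e\<in>F. a e = k}) ` (a ` F - {a e0})"
  have SA_ins: "SA = insert s0 SA'" using e0 by (auto simp: SA_def SA'_def s0_def)
  \<comment> \<open>Both families of fibre indicators sum to the indicator of \<open>F\<close>, so one of them is redundant.\<close>
  have sumA: "(\<Sum>k\<in>a ` F. I {e\<in>F. a e = k}) = I F"
    unfolding I_def using sum.image_gen[OF fin(1), of "\<lambda>e. axis e (1::real)" a] by simp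
  have sumB: "(\<Sum>k\<in>b ` F. I {e\<in>F. b e = k}) = I F"
    unfolding I_def using sum.image_gen[OF fin(1), of "\<lambda>e. axis e (1::real)" b] by simp
  have "s0 = I F - (\<Sum>k\<in>a ` F - {a e0}. I {e\<in>F. a e = k})"
    using sumA e0 by (simp add: s0_def sum.remove[of "a ` F" "a e0"] fin algebra_simps)
  moreover have "I F \<in> span (SA' \<union> SB)"
    unfolding sumB[symmetric] by (rule span_sum) (auto simp: SB_def intro: span_base)
  moreover have "(\<Sum>k\<in>a ` F - {a e0}. I {e\<in>F. a e = k}) \<in> span (SA' \<union> SB)"
    by (rule span_sum) (auto simp: SA'_def intro!: span_base)
  ultimately have "s0 \<in> span (SA' \<union> SB)" by (simp add: span_diff)
  then have sp: "span (SA \<union> SB) = span (SA' \<union> SB)"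
    by (simp add: SA_ins span_redundant)
  have "dim (SA \<union> SB) = dim (SA' \<union> SB)" by (metis sp dim_span)
  also have "\<dots> \<le> card (SA' \<union> SB)" by (rule dim_le_card') (simp add: SA'_def fin)
  also have "\<dots> \<le> card SA' + card SB" by (rule card_Un_le)
  \<comment> \<open>Dropping the fibre of \<open>e0\<close> makes the count strict; without this the
    bound would only be |F|, which leaves no room for \<open>z\<close>.\<close>
  also have "\<dots> \<le> card (a ` F - {a e0}) + card (b ` F)"
    unfolding SA'_def SB_def by (intro add_mono card_image_le) (auto simp: fin)
  also have "\<dots> < card (a ` F) + card (b ` F)"
    using e0 by (intro add_strict_right_mono card_Diff1_less) auto
  also have "\<dots> \<le> card F"
    using fibres_card_le[OF fin(1) a] fibres_card_le[OF fin(1) b] by simp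
  also have "card F = card T"
    unfolding T_def by (rule card_image[symmetric]) (auto simp: inj_on_def axis_eq_axis)
  also have "\<dots> = dim T"
  proof (rule dim_eq_card_independent[symmetric])
    show "independent T"
      by (rule independent_mono[OF independent_Basis]) (auto simp: T_def Basis_vec_def)
  qed
  finally have less: "dim (SA \<union> SB) < dim T" .
  have IT: "I X \<in> span T" if "X \<subseteq> F" for X
    unfolding I_def using that by (intro span_sum span_base) (auto simp: T_def)
  have "SA \<union> SB \<subseteq> span T" by (auto simp: SA_def SB_def intro: IT)
  then have "span (SA \<union> SB) \<subseteq> span T" by (simp add: span_minimal)
  moreover have "span (SA \<union> SB) \<noteq> span T" using less by (metis dim_span less_irrefl)
  ultimately obtain z where z: "z \<noteq> 0" "z \<in> span T" "\<And>y. y \<in> span (SA \<union> SB) \<Longrightarrow> orthogonal z y"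
    using orthogonal_to_subspace_exists_gen[of "SA \<union> SB" T] by blast
  have zI: "z \<bullet> I X = sum (($) z) X" for X
    by (simp add: I_def inner_sum_right inner_axis)
  show ?thesis
  proof
    show "z \<noteq> 0" by fact
    show "z $ e = 0" if "e \<notin> F" for e
    proof -
      have "span T \<subseteq> {y. y $ e = 0}"
        by (rule span_minimal) (use that in \<open>auto simp: T_def axis_def subspace_def\<close>)
      with z show ?thesis by auto
    qed
    show "sum (($) z) {e\<in>F. a e = k} = 0" for k
    proof (cases "k \<in> a ` F")
      case True
      then have "I {e\<in>F. a e = k} \<in> span (SA \<union> SB)" by (auto simp: SA_def intro!: span_base)
      from z(3)[OF this] show ?thesis by (simp add: orthogonal_def zI)
    next
      case False
      then have "{e\<in>F. a e = k} = {}" by auto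
      then show ?thesis by (simp only: sum.empty)
    qed
    show "sum (($) z) {e\<in>F. b e = k} = 0" for k
    proof (cases "k \<in> b ` F")
      case True
      then have "I {e\<in>F. b e = k} \<in> span (SA \<union> SB)" by (auto simp: SB_def intro!: span_base)
      from z(3)[OF this] show ?thesis by (simp add: orthogonal_def zI)
    next
      case False
      then have "{e\<in>F. b e = k} = {}" by auto
      then show ?thesis by (simp only: sum.empty)
    qed
  qed
qed

section \<open>Base polytopes of submodular functions and their tight sets\<close>

text \<open>The values of \<open>f\<close> are integers so that sums over tight sets are integral.
  Bounds on single coordinates are imposed separately where they are used.\<close>

definition base_polytope :: "('e::finite set \<Rightarrow> int) \<Rightarrow> (real^'e) set" where
  "base_polytope f = {y. (\<forall>A. sum (($) y) A \<le> of_int (f A)) \<and> sum (($) y) UNIV = of_int (f UNIV)}"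

definition submodular :: "('e set \<Rightarrow> int) \<Rightarrow> bool" where
  "submodular f \<longleftrightarrow> (\<forall>A B. f (A \<union> B) + f (A \<inter> B) \<le> f A + f B)"

definition tight_sets :: "('e::finite set \<Rightarrow> int) \<Rightarrow> real^'e \<Rightarrow> 'e set set" where
  "tight_sets f y = {A. sum (($) y) A = of_int (f A)}"

text \<open>Uncrossing: the sum of \<open>y\<close> is modular and \<open>f\<close> is submodular,
  so neither of the inequalities for the union and the intersection can be strict.\<close>

lemma tight_sets_Un_Int:
  assumes "submodular f" "y \<in> base_polytope f" "A \<in> tight_sets f y" "B \<in> tight_sets f y"
  shows "A \<union> B \<in> tight_sets f y" "A \<inter> B \<in> tight_sets f y"
proof -
  have 1: "sum (($) y) (A \<union> B) + sum (($) y) (A \<inter> B) = sum (($) y) A + sum (($) y) B"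
    by (rule sum.union_inter) auto
  have 2: "of_int (f (A \<union> B)) + of_int (f (A \<inter> B)) \<le> (of_int (f A) + of_int (f B) :: real)"
    using assms(1) by (simp only: submodular_def of_int_add[symmetric] of_int_le_iff)
  have "sum (($) y) (A \<union> B) \<le> of_int (f (A \<union> B))" "sum (($) y) (A \<inter> B) \<le> of_int (f (A \<inter> B))"
    using assms(2) by (auto simp: base_polytope_def)
  with 1 2 assms(3,4) show "A \<union> B \<in> tight_sets f y" "A \<inter> B \<in> tight_sets f y"
    by (auto simp: tight_sets_def)
qed

text \<open>The atom of \<open>e0\<close> in the lattice of tight sets is \<open>A - B\<close>,
  where \<open>A\<close> is the least tight set containing \<open>e0\<close> and \<open>B\<close> is
  the greatest tight subset of \<open>A\<close> avoiding \<open>e0\<close>. Its sum is a difference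
  of two values of \<open>f\<close>.\<close>

lemma tight_sets_atom_sum_Ints:
  assumes f: "submodular f" "f {} = 0" and y: "y \<in> base_polytope f"
  shows "sum (($) y) {e. {A \<in> tight_sets f y. e \<in> A} = {A \<in> tight_sets f y. e0 \<in> A}} \<in> \<int>"
    (is "sum _ ?D \<in> _")
proof -
  let ?T = "tight_sets f y"
  define A where "A = \<Inter>{A\<in>?T. e0 \<in> A}"
  define B where "B = \<Union>{B\<in>?T. B \<subseteq> A \<and> e0 \<notin> B}"
  have U: "UNIV \<in> ?T" and E: "{} \<in> ?T"
    using y f(2) by (auto simp: base_polytope_def tight_sets_def)
  have INT: "\<Inter>X \<in> ?T" if "X \<subseteq> ?T" for X
    using finite[of X] that
    by (induction X rule: finite_induct) (auto simp: U intro: tight_sets_Un_Int(2)[OF f(1) y])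
  have UN: "\<Union>X \<in> ?T" if "X \<subseteq> ?T" for X
    using finite[of X] that
    by (induction X rule: finite_induct) (auto simp: E intro: tight_sets_Un_Int(1)[OF f(1) y])
  have AT: "A \<in> ?T" unfolding A_def by (rule INT) auto
  have BT: "B \<in> ?T" unfolding B_def by (rule UN) auto
  have eA: "e0 \<in> A" "e0 \<notin> B" "B \<subseteq> A" by (auto simp: A_def B_def)
  have "?D = A - B"
  proof (intro equalityI subsetI)
    fix e assume "e \<in> ?D"
    then have "e \<in> X \<longleftrightarrow> e0 \<in> X" if "X \<in> ?T" for X using that by blast
    with AT BT eA show "e \<in> A - B" by blast
  next
    fix e assume e: "e \<in> A - B"
    have "e \<in> X \<longleftrightarrow> e0 \<in> X" if X: "X \<in> ?T" for X
    proof
      assume "e0 \<in> X" then show "e \<in> X" using e X by (auto simp: A_def)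
    next
      assume "e \<in> X"
      show "e0 \<in> X"
      proof (rule ccontr)
        assume "e0 \<notin> X"
        \<comment> \<open>\<open>X \<inter> A\<close> is tight, lies in \<open>A\<close> and avoids
          \<open>e0\<close>, so it is one of the sets united in \<open>B\<close>.\<close>
        then have "X \<inter> A \<subseteq> B" using tight_sets_Un_Int(2)[OF f(1) y X AT] by (auto simp: B_def)
        with \<open>e \<in> X\<close> e show False by blast
      qed
    qed
    then show "e \<in> ?D" by blast
  qed
  then have "sum (($) y) ?D = sum (($) y) A - sum (($) y) B"
    using eA(3) by (simp add: sum_diff)
  also have "\<dots> = of_int (f A - f B)" using AT BT by (simp add: tight_sets_def)
  finally show ?thesis by (metis Ints_of_int)
qed

section \<open>Perturbation and integrality of extreme points\<close>

lemma Ints_sum_other_fractional: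
  fixes y :: "'e \<Rightarrow> real"
  assumes "finite D" "sum y D \<in> \<int>" "e \<in> D" "y e \<notin> \<int>"
  shows "\<exists>e'\<in>D. e' \<noteq> e \<and> y e' \<notin> \<int>"
proof (rule ccontr)
  assume "\<not> ?thesis"
  then have "sum y (D - {e}) \<in> \<int>" by (intro Ints_sum) auto
  moreover have "y e = sum y D - sum y (D - {e})" using assms by (simp add: sum.remove)
  ultimately show False using assms by (metis Ints_diff)
qed

text \<open>Used to keep finitely many slack constraints valid under a small move. The absolute
  value covers a move along \<open>g\<close> and its opposite at once.\<close>

lemma small_step_exists:
  fixes l u :: "'i \<Rightarrow> real"
  assumes "finite I" "\<And>i. i \<in> I \<Longrightarrow> l i < u i"
  obtains \<epsilon> :: real where "\<epsilon> > 0" "\<And>i. i \<in> I \<Longrightarrow> l i + \<epsilon> * \<bar>g i\<bar> \<le> u i"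
proof -
  have "\<exists>\<epsilon>>0. \<forall>i\<in>I. l i + \<epsilon> * \<bar>g i\<bar> \<le> u i"
    using assms
  proof (induction I rule: finite_induct)
    case empty
    then show ?case by (auto intro: exI[of _ 1])
  next
    case (insert i I)
    then obtain \<epsilon> where e: "\<epsilon> > 0" "\<forall>i\<in>I. l i + \<epsilon> * \<bar>g i\<bar> \<le> u i" by auto
    \<comment> \<open>The added 1 keeps the denominator positive when
      \<open>g i = 0\<close>.\<close>
    define d where "d = min \<epsilon> ((u i - l i) / (\<bar>g i\<bar> + 1))"
    have pos: "u i - l i > 0" using insert.prems[of i] by simp
    then have "d > 0" using e by (simp add: d_def)
    have "d * \<bar>g i\<bar> \<le> (u i - l i) / (\<bar>g i\<bar> + 1) * \<bar>g i\<bar>"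
      by (intro mult_right_mono) (auto simp: d_def)
    also have "\<dots> \<le> (u i - l i) / (\<bar>g i\<bar> + 1) * (\<bar>g i\<bar> + 1)"
      using pos by (intro mult_left_mono) auto
    also have "\<dots> = u i - l i" by (simp add: add_nonneg_eq_0_iff)
    finally have 1: "l i + d * \<bar>g i\<bar> \<le> u i" by simp
    have "l j + d * \<bar>g j\<bar> \<le> u j" if "j \<in> I" for j
    proof -
      have "d * \<bar>g j\<bar> \<le> \<epsilon> * \<bar>g j\<bar>" by (intro mult_right_mono) (auto simp: d_def)
      with e that show ?thesis by force
    qed
    with 1 \<open>d > 0\<close> show ?case by auto
  qed
  then show ?thesis using that by blast
qed

lemma extreme_point_base_polytope_fibres_integral:
  fixes x y :: "real^'e::finite" and d :: "'e \<Rightarrow> 'b"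
  assumes f: "submodular f" "f {} = 0"
    and x: "\<And>k. sum (($) x) {e. d e = k} \<in> \<int>"
    and ext: "y extreme_point_of {y \<in> base_polytope f. (\<forall>e. y $ e \<in> {0..1}) \<and>
              (\<forall>k. sum (($) y) {e. d e = k} = sum (($) x) {e. d e = k})}" (is "_ extreme_point_of ?Q")
  shows "y $ e \<in> {0, 1}"
proof (rule ccontr)
  assume e: "y $ e \<notin> {0, 1}"
  have yQ: "y \<in> ?Q" using ext by (simp add: extreme_point_of_def)
  then have yB: "y \<in> base_polytope f" and y01: "\<And>e. 0 \<le> y $ e \<and> y $ e \<le> 1" by auto
  have Ints_iff: "y $ e \<in> \<int> \<longleftrightarrow> y $ e \<in> {0, 1}" for e
    using y01[of e] by (auto elim!: Ints_cases)
  define F where "F = {e. y $ e \<notin> \<int>}"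
  have Fpos: "0 < y $ e" "y $ e < 1" if "e \<in> F" for e
    using that y01[of e] by (auto simp: F_def Ints_iff less_le)
  let ?T = "tight_sets f y"
  \<comment> \<open>The fibres of \<open>a\<close> are the atoms of the lattice of tight
    sets.\<close>
  define a where "a e = {A \<in> ?T. e \<in> A}" for e
  have "F \<noteq> {}" using e by (auto simp: F_def Ints_iff)
  moreover have "\<exists>e'\<in>F. e' \<noteq> e \<and> a e' = a e" if "e \<in> F" for e
    using Ints_sum_other_fractional[of "{e'. a e' = a e}" "($) y" e] that
      tight_sets_atom_sum_Ints[OF f yB, of e] by (auto simp: F_def a_def)
  moreover have "\<exists>e'\<in>F. e' \<noteq> e \<and> d e' = d e" if "e \<in> F" for e
    using Ints_sum_other_fractional[of "{e'. d e' = d e}" "($) y" e] that x[of "d e"] yQ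
    by (auto simp: F_def)
  ultimately obtain z :: "real^'e" where z: "z \<noteq> 0" "\<And>e. e \<notin> F \<Longrightarrow> z $ e = 0"
    "\<And>k. sum (($) z) {e\<in>F. a e = k} = 0" "\<And>k. sum (($) z) {e\<in>F. d e = k} = 0"
    by (rule exists_balanced_vector[of F a d]) auto
  have zF: "sum (($) z) A = sum (($) z) (A \<inter> F)" for A
    by (rule sum.mono_neutral_right) (auto simp: z(2))
  have zd: "sum (($) z) {e. d e = k} = 0" for k
    using z(4)[of k] by (subst zF) (simp add: Int_def conj_commute)
  \<comment> \<open>A tight set is a union of atoms, and \<open>z\<close> sums to zero on the part
    of each atom in \<open>F\<close>. Hence tight constraints stay tight along
    \<open>z\<close>.\<close>
  have zT: "sum (($) z) A = 0" if "A \<in> ?T" for A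
  proof -
    have "sum (($) z) (A \<inter> F) = (\<Sum>k\<in>a ` (A \<inter> F). sum (($) z) {e\<in>A \<inter> F. a e = k})"
      by (rule sum.image_gen) simp
    also have "\<dots> = 0"
    proof (rule sum.neutral, safe)
      fix e assume "e \<in> A" "e \<in> F"
      then have "{e'\<in>A \<inter> F. a e' = a e} = {e'\<in>F. a e' = a e}"
        using that unfolding a_def by blast
      then show "sum (($) z) {e'\<in>A \<inter> F. a e' = a e} = 0" using z(3) by simp
    qed
    finally show ?thesis using zF by simp
  qed
  \<comment> \<open>Three step sizes follow: for the slack rank constraints, for the upper bounds
    and for the lower bounds. The bounds are slack on \<open>F\<close>, and \<open>z\<close>
    vanishes elsewhere.\<close>
  obtain \<epsilon>1 where e1: "\<epsilon>1 > 0"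
    "\<And>A. A \<in> - ?T \<Longrightarrow> sum (($) y) A + \<epsilon>1 * \<bar>sum (($) z) A\<bar> \<le> of_int (f A)"
  proof (rule small_step_exists[of "- ?T" "\<lambda>A. sum (($) y) A" "\<lambda>A. of_int (f A)" "sum (($) z)"])
    show "sum (($) y) A < of_int (f A)" if "A \<in> - ?T" for A
      using that yB by (auto simp: tight_sets_def base_polytope_def less_le)
  qed auto
  obtain \<epsilon>2 where e2: "\<epsilon>2 > 0" "\<And>e. e \<in> F \<Longrightarrow> y $ e + \<epsilon>2 * \<bar>z $ e\<bar> \<le> 1"
    by (rule small_step_exists[of F "($) y" "\<lambda>_. 1" "($) z"]) (auto simp: Fpos)
  obtain \<epsilon>3 where e3: "\<epsilon>3 > 0" "\<And>e. e \<in> F \<Longrightarrow> 0 + \<epsilon>3 * \<bar>z $ e\<bar> \<le> y $ e"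
    by (rule small_step_exists[of F "\<lambda>_. 0" "($) y" "($) z"]) (auto simp: Fpos)
  define \<epsilon> where "\<epsilon> = min \<epsilon>1 (min \<epsilon>2 \<epsilon>3)"
  have pos: "\<epsilon> > 0" using e1 e2 e3 by (simp add: \<epsilon>_def)
  have le: "\<epsilon> \<le> \<epsilon>1" "\<epsilon> \<le> \<epsilon>2" "\<epsilon> \<le> \<epsilon>3" by (auto simp: \<epsilon>_def)
  have step: "y + s *\<^sub>R z \<in> ?Q" if s: "\<bar>s\<bar> = \<epsilon>" for s
  proof -
    have sums: "sum (($) (y + s *\<^sub>R z)) A = sum (($) y) A + s * sum (($) z) A" for A
      by (simp add: sum.distrib sum_distrib_left)
    have abs: "s * t \<le> \<epsilon>' * \<bar>t\<bar>" "- (\<epsilon>' * \<bar>t\<bar>) \<le> s * t" if "\<epsilon> \<le> \<epsilon>'" for t \<epsilon>'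
    proof -
      have "\<bar>s * t\<bar> \<le> \<epsilon>' * \<bar>t\<bar>" using s that by (simp add: abs_mult mult_right_mono)
      then show "s * t \<le> \<epsilon>' * \<bar>t\<bar>" "- (\<epsilon>' * \<bar>t\<bar>) \<le> s * t" by linarith+
    qed
    have "sum (($) y) A + s * sum (($) z) A \<le> of_int (f A)" for A
    proof (cases "A \<in> ?T")
      case True
      then show ?thesis using zT by (simp add: tight_sets_def)
    next
      case False
      then show ?thesis using e1(2)[of A] abs(1)[OF le(1), of "sum (($) z) A"] by simp
    qed
    moreover have "sum (($) y) UNIV + s * sum (($) z) UNIV = of_int (f UNIV)"
      using zT[of UNIV] yB by (simp add: base_polytope_def tight_sets_def)
    moreover have "0 \<le> y $ e + s * z $ e \<and> y $ e + s * z $ e \<le> 1" for e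
    proof (cases "e \<in> F")
      case True
      then show ?thesis
        using e2(2)[of e] e3(2)[of e] abs(1)[OF le(2), of "z $ e"] abs(2)[OF le(3), of "z $ e"]
        by linarith
    next
      case False
      then show ?thesis using z(2) y01 by simp
    qed
    ultimately show ?thesis using yQ zd unfolding base_polytope_def mem_Collect_eq sums by auto
  qed
  \<comment> \<open>Both endpoints lie in the polytope, so \<open>y\<close> is interior to a segment
    of it, against extremality.\<close>
  have "y = midpoint (y + \<epsilon> *\<^sub>R z) (y + (- \<epsilon>) *\<^sub>R z)"
    by (simp add: midpoint_def algebra_simps scaleR_2[symmetric])
  moreover have "y + \<epsilon> *\<^sub>R z \<noteq> y + (- \<epsilon>) *\<^sub>R z"
    using pos z(1) by (simp del: scaleR_minus_left)
  ultimately have "y \<in> open_segment (y + \<epsilon> *\<^sub>R z) (y + (- \<epsilon>) *\<^sub>R z)"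
    by (metis midpoint_in_open_segment)
  moreover have "y + \<epsilon> *\<^sub>R z \<in> ?Q" "y + (- \<epsilon>) *\<^sub>R z \<in> ?Q"
    by (rule step, use pos in simp)+
  ultimately show False using ext unfolding extreme_point_of_def by blast
qed

text \<open>Adding the unit box and the fibre equations of \<open>x\<close> gives a compact convex
  set, which is the hull of its extreme points by Krein-Milman; these are 0/1 vectors by the
  preceding lemma.\<close>

lemma base_polytope_in_hull_of_integral_fibres:
  fixes x :: "real^'e::finite" and d :: "'e \<Rightarrow> 'b"
  assumes f: "submodular f" "f {} = 0"
    and x: "x \<in> base_polytope f" "\<And>e. x $ e \<in> {0..1}" "\<And>k. sum (($) x) {e. d e = k} \<in> \<int>"
  shows "x \<in> convex hull {y \<in> base_polytope f. (\<forall>e. y $ e \<in> {0, 1}) \<and>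
           (\<forall>k. sum (($) y) {e. d e = k} = sum (($) x) {e. d e = k})}"
proof -
  let ?Q = "{y \<in> base_polytope f. (\<forall>e. y $ e \<in> {0..1}) \<and>
             (\<forall>k. sum (($) y) {e. d e = k} = sum (($) x) {e. d e = k})}"
  have Q_eq: "?Q = (\<Inter>A. {y. sum (($) y) A \<le> of_int (f A)}) \<inter> {y. sum (($) y) UNIV = of_int (f UNIV)}
      \<inter> cbox 0 1 \<inter> (\<Inter>k. {y. sum (($) y) {e. d e = k} = sum (($) x) {e. d e = k}})"
    by (auto simp: base_polytope_def mem_box_cart)
  have lin: "linear (\<lambda>y::real^'e. sum (($) y) A)" for A
    by (rule linearI) (simp_all add: sum.distrib sum_distrib_left)
  have "closed ?Q"
    unfolding Q_eq
    by (intro closed_Int closed_INT ballI closed_cbox closed_Collect_le closed_Collect_eq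
        continuous_intros)
  moreover have "bounded ?Q"
    unfolding Q_eq by (rule bounded_subset[OF bounded_cbox]) blast
  ultimately have "compact ?Q" by (simp add: compact_eq_bounded_closed)
  moreover have "convex ?Q"
  proof -
    have "convex {y::real^'e. sum (($) y) A \<le> c}" for A c
      using convex_linear_vimage[OF lin convex_real_interval(2), of A c] by (simp add: vimage_def)
    moreover have "convex {y::real^'e. sum (($) y) A = c}" for A c
      using convex_linear_vimage[OF lin convex_singleton, of A c] by (simp add: vimage_def)
    ultimately show ?thesis
      unfolding Q_eq by (intro convex_Int convex_INT convex_box) auto
  qed
  ultimately have "?Q = convex hull {y. y extreme_point_of ?Q}" by (rule Krein_Milman_Minkowski)
  moreover have "{y. y extreme_point_of ?Q} \<subseteq> {y \<in> base_polytope f. (\<forall>e. y $ e \<in> {0, 1}) \<and>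
           (\<forall>k. sum (($) y) {e. d e = k} = sum (($) x) {e. d e = k})}"
  proof safe
    fix y assume y: "y extreme_point_of ?Q"
    then have "y \<in> ?Q" by (simp add: extreme_point_of_def)
    then show "y \<in> base_polytope f"
      and "\<And>k. sum (($) y) {e. d e = k} = sum (($) x) {e. d e = k}" by auto
    fix e assume "y $ e \<noteq> 0" "y $ e \<notin> {}"
    then show "y $ e = 1"
      using extreme_point_base_polytope_fibres_integral[OF f x(3) y, of e] by blast
  qed
  moreover have "x \<in> ?Q" using x by auto
  ultimately show ?thesis using hull_mono by blast
qed

section \<open>The graphic rank as a dimension\<close>

text \<open>Columns of the oriented incidence matrix, which represent the graphic matroid over the
  reals. Both orientations occur, which does not affect the span, and members of \<open>A\<close>
  that are not edges contribute nothing.\<close>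

definition edge_vectors :: "'v::finite set set \<Rightarrow> (real^'v) set" where
  "edge_vectors A = {axis u 1 - axis v 1 | u v. u \<noteq> v \<and> {u, v} \<in> A}"

definition edge_rank :: "'v::finite set set \<Rightarrow> nat" where
  "edge_rank A = dim (edge_vectors A)"

lemma edge_rank_empty: "edge_rank {} = 0"
  by (simp add: edge_rank_def edge_vectors_def)

lemma edge_rank_mono: "A \<subseteq> B \<Longrightarrow> edge_rank A \<le> edge_rank B"
  unfolding edge_rank_def by (rule dim_subset) (auto simp: edge_vectors_def)

text \<open>The dimension formula for the sum and the intersection of two subspaces; the vectors of
  \<open>A \<inter> B\<close> lie in the intersection of the two spans.\<close>

lemma edge_rank_submodular:
  "edge_rank (A \<union> B) + edge_rank (A \<inter> B) \<le> edge_rank A + edge_rank B"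
proof -
  let ?V = "edge_vectors :: 'a set set \<Rightarrow> (real^'a) set"
  have "?V (A \<union> B) = ?V A \<union> ?V B" by (auto simp: edge_vectors_def)
  then have 1: "edge_rank (A \<union> B) = dim {x + y |x y. x \<in> span (?V A) \<and> y \<in> span (?V B)}"
    by (simp add: edge_rank_def span_Un[symmetric])
  have "?V (A \<inter> B) \<subseteq> span (?V A) \<inter> span (?V B)"
    by (auto simp: edge_vectors_def intro!: span_base)
  then have 2: "edge_rank (A \<inter> B) \<le> dim (span (?V A) \<inter> span (?V B))"
    unfolding edge_rank_def by (rule dim_subset)
  from 1 2 show ?thesis
    using dim_sums_Int[OF subspace_span subspace_span, of "?V A" "?V B"]
    by (simp add: edge_rank_def)
qed

lemma doubleton_in_K_edges_iff: "{u, v} \<in> K_edges \<longleftrightarrow> u \<noteq> v"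
  by (auto simp: K_edges_def card_2_iff)

lemma K_edgesE:
  assumes "e \<in> K_edges" obtains u v where "e = {u, v}" "u \<noteq> v"
  using assms by (auto simp: K_edges_def card_2_iff)

text \<open>Fix a node \<open>s\<close> of \<open>S\<close>. Every edge vector within
  \<open>S\<close> is a difference of two vectors of the star at \<open>s\<close>, and this star has
  only \<open>card S - 1\<close> nonzero vectors.\<close>

lemma edge_rank_less_card:
  assumes "S \<noteq> {}" and "\<And>e. e \<in> A \<Longrightarrow> e \<in> K_edges \<Longrightarrow> e \<subseteq> S"
  shows "edge_rank A < card S"
proof -
  obtain s where s: "s \<in> S" using assms by blast
  let ?B = "(\<lambda>u. axis u 1 - axis s 1 :: real^'a) ` (S - {s})"
  have in_span: "axis u 1 - axis s 1 \<in> span ?B" if "u \<in> S" for u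
    using that by (cases "u = s") (auto intro: span_base span_zero)
  have "edge_vectors A \<subseteq> span ?B"
  proof
    fix w assume "w \<in> edge_vectors A"
    then obtain u v where uv: "w = axis u 1 - axis v 1" "u \<noteq> v" "{u, v} \<in> A"
      by (auto simp: edge_vectors_def)
    with assms(2)[of "{u, v}"] have "u \<in> S" "v \<in> S" by (auto simp: doubleton_in_K_edges_iff)
    then have "(axis u 1 - axis s 1) - (axis v 1 - axis s 1) \<in> span ?B"
      by (intro span_diff in_span)
    then show "w \<in> span ?B" using uv by simp
  qed
  then have "edge_rank A \<le> dim ?B" unfolding edge_rank_def by (metis dim_span dim_subset)
  also have "\<dots> \<le> card ?B" by (rule dim_le_card') simp
  also have "\<dots> \<le> card (S - {s})" by (rule card_image_le) simp
  also have "\<dots> < card S" using s by (intro card_Diff1_less) auto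
  finally show ?thesis .
qed

text \<open>The orthogonal complement of the edge vectors consists of the functions that are constant on
  connected components, so the rank of \<open>A\<close> is at least the sum of \<open>card C - 1\<close> over the components.\<close>

lemma sum_le_edge_rank:
  fixes x :: "'v::finite set \<Rightarrow> real"
  assumes A: "A \<subseteq> K_edges"
    and x: "\<And>S. S \<noteq> {} \<Longrightarrow> sum x {e\<in>A. e \<subseteq> S} \<le> real (card S) - 1"
  shows "sum x A \<le> real (edge_rank A)"
proof -
  define R where "R = {(a, b). {a, b} \<in> A}\<^sup>*"
  define c where "c v = R `` {v}" for v
  define Cs where "Cs = range c"
  have "sym {(a, b). {a, b} \<in> A}" by (auto simp: sym_def insert_commute)
  then have symR: "sym R" unfolding R_def by (rule sym_rtrancl)
  have transR: "trans R" unfolding R_def by (rule trans_rtrancl)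
  have self: "v \<in> c v" for v by (auto simp: c_def R_def)
  have c_eq: "c u = c v" if "v \<in> c u" for u v
    using that symR transR unfolding c_def by (auto dest: symD transD)
  have mem_Cs: "v \<in> C \<longleftrightarrow> C = c v" if "C \<in> Cs" for v C
    using that self c_eq by (auto simp: Cs_def)
  have disj: "C \<inter> D = {}" if "C \<in> Cs" "D \<in> Cs" "C \<noteq> D" for C D
    using that mem_Cs by blast
  have edge_sub: "{u, v} \<subseteq> c u" if "{u, v} \<in> A" for u v
    using that self by (auto simp: c_def R_def)
  have A_eq: "A = (\<Union>C\<in>Cs. {e\<in>A. e \<subseteq> C})"
  proof (intro equalityI subsetI)
    fix e assume e: "e \<in> A"
    then have "e \<in> K_edges" using A by blast
    then obtain u v where "e = {u, v}" by (rule K_edgesE)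
    with e edge_sub show "e \<in> (\<Union>C\<in>Cs. {e\<in>A. e \<subseteq> C})" by (auto simp: Cs_def)
  qed auto
  have "sum x A = sum x (\<Union>C\<in>Cs. {e\<in>A. e \<subseteq> C})" using A_eq by simp
  also have "\<dots> = (\<Sum>C\<in>Cs. sum x {e\<in>A. e \<subseteq> C})"
  proof (rule sum.UNION_disjoint)
    show "\<forall>C\<in>Cs. \<forall>D\<in>Cs. C \<noteq> D \<longrightarrow> {e\<in>A. e \<subseteq> C} \<inter> {e\<in>A. e \<subseteq> D} = {}"
    proof (intro ballI impI equals0I)
      fix C D e assume h: "C \<in> Cs" "D \<in> Cs" "C \<noteq> D" and e: "e \<in> {e\<in>A. e \<subseteq> C} \<inter> {e\<in>A. e \<subseteq> D}"
      then have "e \<noteq> {}" using A by (auto simp: K_edges_def)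
      with e disj[OF h] show False by blast
    qed
  qed auto
  also have "\<dots> \<le> (\<Sum>C\<in>Cs. real (card C) - 1)"
    by (rule sum_mono, rule x) (use self in \<open>auto simp: Cs_def\<close>)
  also have "\<dots> = real (\<Sum>C\<in>Cs. card C) - real (card Cs)"
    by (simp add: sum_subtractf)
  also have "(\<Sum>C\<in>Cs. card C) = card (\<Union>Cs)"
    by (rule card_Union_disjoint[symmetric]) (simp_all add: pairwise_def disjnt_def disj)
  also have "\<Union>Cs = UNIV" using self by (auto simp: Cs_def)
  also have "real CARD('v) - real (card Cs) \<le> real (edge_rank A)"
  proof -
    let ?V = "edge_vectors A"
    let ?O = "{y \<in> UNIV. \<forall>w\<in>span ?V. orthogonal w y}"
    define I :: "'v set \<Rightarrow> real^'v" where "I C = (\<chi> v. if v \<in> C then 1 else 0)" for C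
    have "?O \<subseteq> span (I ` Cs)"
    proof
      fix y assume "y \<in> ?O"
      then have orth: "w \<bullet> y = 0" if "w \<in> ?V" for w
        using that by (auto simp: orthogonal_def span_base)
      have step: "y $ a = y $ b" if "{a, b} \<in> A" for a b
      proof (cases "a = b")
        case False
        then have "axis a 1 - axis b 1 \<in> ?V" using that by (auto simp: edge_vectors_def)
        from orth[OF this] show ?thesis by (simp add: inner_diff_left inner_axis')
      qed simp
      have const: "y $ u = y $ v" if "(u, v) \<in> R" for u v
        using that unfolding R_def by (induction rule: rtrancl_induct) (auto dest: step)
      \<comment> \<open>The choice is immaterial, as \<open>y\<close> is constant on each component;
        \<open>t C\<close> is its value there.\<close>
      define t where "t C = y $ (SOME v. v \<in> C)" for C
      have t: "t (c v) = y $ v" for v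
        using someI[of "\<lambda>u. u \<in> c v", OF self] const[of v] by (auto simp: t_def c_def)
      have "y = (\<Sum>C\<in>Cs. t C *\<^sub>R I C)"
      proof (subst vec_eq_iff, rule allI)
        fix v
        have "(\<Sum>C\<in>Cs. t C *\<^sub>R I C) $ v = (\<Sum>C\<in>Cs. if C = c v then t C else 0)"
          unfolding sum_component by (rule sum.cong) (auto simp: I_def mem_Cs)
        also have "\<dots> = y $ v" using t by (simp add: Cs_def)
        finally show "y $ v = (\<Sum>C\<in>Cs. t C *\<^sub>R I C) $ v" by simp
      qed
      also have "\<dots> \<in> span (I ` Cs)" by (intro span_sum span_scale span_base) auto
      finally show "y \<in> span (I ` Cs)" .
    qed
    then have "dim ?O \<le> dim (span (I ` Cs))" by (rule dim_subset)
    also have "\<dots> = dim (I ` Cs)" by (rule dim_span)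
    also have "\<dots> \<le> card (I ` Cs)" by (rule dim_le_card') simp
    also have "\<dots> \<le> card Cs" by (rule card_image_le) simp
    finally have "dim ?O \<le> card Cs" .
    moreover have "dim ?O + dim (span ?V) = dim (UNIV :: (real^'v) set)"
      by (rule dim_subspace_orthogonal_to_vectors) auto
    ultimately show ?thesis by (simp add: edge_rank_def)
  qed
  finally show ?thesis .
qed

section \<open>Degree counting and a counting criterion for spanning trees\<close>

lemma cut_singleton: "cut {v} = {e \<in> K_edges. v \<in> e}"
  by (auto simp: cut_def Int_insert_right split: if_splits)

text \<open>Double counting: an edge inside \<open>S\<close> is seen from both its endpoints, an
  edge of the cut from one.\<close>

lemma sum_cut_singletons:
  fixes x :: "real ^ ('v::finite set)"
  shows "(\<Sum>v\<in>S. edge_sum x (cut {v})) = 2 * edge_sum x {e\<in>K_edges. e \<subseteq> S} + edge_sum x (cut S)"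
proof -
  have "(\<Sum>v\<in>S. edge_sum x (cut {v})) = (\<Sum>v\<in>S. \<Sum>e\<in>K_edges. if v \<in> e then x $ e else 0)"
    unfolding edge_sum_def cut_singleton by (rule sum.cong) (auto simp: sum.inter_filter)
  also have "\<dots> = (\<Sum>e\<in>K_edges. \<Sum>v\<in>S. if v \<in> e then x $ e else 0)" by (rule sum.swap)
  also have "\<dots> = (\<Sum>e\<in>K_edges. real (card (e \<inter> S)) * x $ e)"
  proof (rule sum.cong[OF refl])
    fix e :: "'v set"
    have "(\<Sum>v\<in>S. if v \<in> e then x $ e else 0) = (\<Sum>v\<in>{v\<in>S. v \<in> e}. x $ e)"
      by (rule sum.inter_filter[symmetric]) simp
    also have "{v\<in>S. v \<in> e} = e \<inter> S" by auto
    finally show "(\<Sum>v\<in>S. if v \<in> e then x $ e else 0) = real (card (e \<inter> S)) * x $ e" by simp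
  qed
  also have "\<dots> = (\<Sum>e\<in>K_edges. (if e \<subseteq> S then 2 * x $ e else 0) + (if card (e \<inter> S) = 1 then x $ e else 0))"
  proof (rule sum.cong[OF refl])
    fix e :: "'v set" assume "e \<in> K_edges"
    then obtain u v where "e = {u, v}" "u \<noteq> v" by (rule K_edgesE)
    then show "real (card (e \<inter> S)) * x $ e =
        (if e \<subseteq> S then 2 * x $ e else 0) + (if card (e \<inter> S) = 1 then x $ e else 0)"
      by (cases "u \<in> S"; cases "v \<in> S") auto
  qed
  also have "\<dots> = 2 * edge_sum x {e\<in>K_edges. e \<subseteq> S} + edge_sum x (cut S)"
    unfolding edge_sum_def cut_def
    by (auto simp: sum.distrib sum.inter_filter sum_distrib_left intro!: sum.cong)
  finally show ?thesis .
qed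

text \<open>If \<open>T\<close> were disconnected, the bounds on a component and on its complement
  would allow at most \<open>card W - 2\<close> edges. A cycle would put as many edges as nodes into
  its own node set.\<close>

lemma spanning_tree_onI:
  fixes T :: "'v::finite set set"
  assumes T: "T \<subseteq> {e \<in> K_edges. e \<subseteq> W}" and "W \<noteq> {}" and card: "card T + 1 = card W"
    and sub: "\<And>S. S \<noteq> {} \<Longrightarrow> S \<subseteq> W \<Longrightarrow> card {e\<in>T. e \<subseteq> S} < card S"
  shows "spanning_tree_on W T"
proof -
  have "connected_graph W T"
    unfolding connected_graph_def
  proof (intro conjI ballI)
    fix u v assume uv: "u \<in> W" "v \<in> W"
    show "(u, v) \<in> {(a, b). {a, b} \<in> T}\<^sup>*" (is "_ \<in> ?R")
    proof (rule ccontr)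
      assume no: "(u, v) \<notin> ?R"
      define S where "S = {w\<in>W. (u, w) \<in> ?R}"
      have S: "S \<noteq> {}" "S \<subseteq> W" "W - S \<noteq> {}" using uv no by (auto simp: S_def)
      have "e \<subseteq> S \<or> e \<subseteq> W - S" if "e \<in> T" for e
      proof -
        from that T have "e \<in> K_edges" "e \<subseteq> W" by auto
        then obtain a b where ab: "e = {a, b}" by (blast elim: K_edgesE)
        with that have "(a, b) \<in> {(a, b). {a, b} \<in> T}" "(b, a) \<in> {(a, b). {a, b} \<in> T}"
          by (auto simp: insert_commute)
        then have "(u, a) \<in> ?R \<longleftrightarrow> (u, b) \<in> ?R" by (meson rtrancl.rtrancl_into_rtrancl)
        with ab \<open>e \<subseteq> W\<close> show ?thesis by (auto simp: S_def)
      qed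
      then have "T = {e\<in>T. e \<subseteq> S} \<union> {e\<in>T. e \<subseteq> W - S}" by auto
      then have "card T \<le> card {e\<in>T. e \<subseteq> S} + card {e\<in>T. e \<subseteq> W - S}"
        by (metis card_Un_le)
      moreover have "card {e\<in>T. e \<subseteq> S} < card S" "card {e\<in>T. e \<subseteq> W - S} < card (W - S)"
        using S by (auto intro!: sub)
      moreover have "card S + card (W - S) = card W"
        using S by (simp add: card_Diff_subset card_mono)
      ultimately show False using card by linarith
    qed
  qed fact
  moreover have "\<not> is_cycle T vs" for vs
  proof
    assume "is_cycle T vs"
    then have len: "length vs \<ge> 3" and dist: "distinct vs"
      and ed: "\<And>i. i < length vs \<Longrightarrow> {vs ! i, vs ! ((i + 1) mod length vs)} \<in> T"
      by (auto simp: is_cycle_def)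
    define k where "k = length vs"
    have "k > 0" using len unfolding k_def by linarith
    define g where "g i = {vs ! i, vs ! ((i + 1) mod k)}" for i
    have suc: "(i + 1) mod k = (if i + 1 = k then 0 else i + 1)" if "i < k" for i
      using that by (simp add: mod_Suc)
    have "inj_on g {..<k}"
    proof (rule inj_onI)
      fix i j assume ij: "i \<in> {..<k}" "j \<in> {..<k}" "g i = g j"
      have nth: "vs ! p = vs ! q \<longleftrightarrow> p = q" if "p < k" "q < k" for p q
        using that dist by (simp add: nth_eq_iff_index_eq k_def)
      have lt: "(i + 1) mod k < k" "(j + 1) mod k < k" using \<open>k > 0\<close> by simp_all
      \<comment> \<open>Equal edges have equal indices or are traversed in opposite directions. In
        the latter case each index is the cyclic successor of the other, which is impossible for
        \<open>k \<ge> 3\<close>.\<close>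
      from ij(3) have "i = j \<or> (i = (j + 1) mod k \<and> (i + 1) mod k = j)"
        unfolding g_def doubleton_eq_iff using ij(1,2) lt by (auto simp: nth)
      moreover have "i < k" "j < k" "k \<ge> 3" using ij(1,2) len by (simp_all add: k_def)
      ultimately show "i = j" using suc[of i] suc[of j] by (simp only: split: if_splits) linarith+
    qed
    then have "k = card (g ` {..<k})" by (simp add: card_image)
    also have "\<dots> \<le> card {e\<in>T. e \<subseteq> set vs}"
    proof (rule card_mono)
      show "g ` {..<k} \<subseteq> {e\<in>T. e \<subseteq> set vs}"
        using ed \<open>k > 0\<close> by (auto simp: g_def k_def)
    qed simp
    also have "\<dots> < card (set vs)"
    proof (rule sub)
      show "set vs \<noteq> {}" using \<open>k > 0\<close> by (simp add: k_def)
      show "set vs \<subseteq> W"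
      proof
        fix v assume "v \<in> set vs"
        then obtain i where i: "i < length vs" "v = vs ! i" by (auto simp: in_set_conv_nth)
        then have "v \<in> {vs ! i, vs ! ((i + 1) mod length vs)}" by simp
        moreover have "{vs ! i, vs ! ((i + 1) mod length vs)} \<subseteq> W" using ed[OF i(1)] T by blast
        ultimately show "v \<in> W" by (rule rev_subsetD)
      qed
    qed
    finally show False using distinct_card[OF dist] by (simp add: k_def)
  qed
  ultimately show ?thesis using T by (auto simp: spanning_tree_on_def)
qed

section \<open>A rank bound for 1-trees and its relation to the subtour polytope\<close>

text \<open>Graphic rank away from \<open>r\<close> plus a term for the edges at \<open>r\<close>.
  That term is 2 even on a single edge, where the matroid rank is 1; the bound of 1 on each
  coordinate, imposed separately, supplies the difference.\<close>

definition one_tree_rank :: "'v::finite \<Rightarrow> 'v set set \<Rightarrow> int" where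
  "one_tree_rank r A = int (edge_rank (A - cut {r})) + (if A \<inter> cut {r} = {} then 0 else 2)"

lemma submodular_one_tree_rank: "submodular (one_tree_rank r)"
  unfolding submodular_def
proof (intro allI)
  fix A B
  have eq: "(A \<union> B) - cut {r} = (A - cut {r}) \<union> (B - cut {r})"
    "(A \<inter> B) - cut {r} = (A - cut {r}) \<inter> (B - cut {r})" by auto
  have "edge_rank ((A \<union> B) - cut {r}) + edge_rank ((A \<inter> B) - cut {r})
      \<le> edge_rank (A - cut {r}) + edge_rank (B - cut {r})"
    unfolding eq by (rule edge_rank_submodular)
  then show "one_tree_rank r (A \<union> B) + one_tree_rank r (A \<inter> B) \<le> one_tree_rank r A + one_tree_rank r B"
    unfolding one_tree_rank_def by auto
qed

lemma one_tree_rank_empty: "one_tree_rank r {} = 0"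
  by (simp add: one_tree_rank_def edge_rank_empty)

lemma one_tree_rank_cut: "one_tree_rank r (cut {r}) \<le> 2"
  by (simp add: one_tree_rank_def edge_rank_empty)

lemma one_tree_rank_inside:
  assumes "S \<noteq> {}" "r \<notin> S"
  shows "one_tree_rank r {e\<in>K_edges. e \<subseteq> S} < int (card S)"
proof -
  have "{e\<in>K_edges. e \<subseteq> S} \<inter> cut {r} = {}" using assms by (auto simp: cut_singleton)
  moreover have "edge_rank ({e\<in>K_edges. e \<subseteq> S} - cut {r}) < card S"
    by (rule edge_rank_less_card) (use assms in auto)
  ultimately show ?thesis by (simp add: one_tree_rank_def)
qed

lemma one_tree_rank_UNIV_le:
  fixes r :: "'v::finite"
  assumes "CARD('v) \<ge> 2"
  shows "one_tree_rank r UNIV \<le> int CARD('v)"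
proof -
  have c: "card (UNIV - {r}) = CARD('v) - 1" by (simp add: card_Diff_singleton)
  have "edge_rank (UNIV - cut {r}) < card (UNIV - {r})"
  proof (rule edge_rank_less_card)
    have "card (UNIV - {r}) > 0" using c assms by linarith
    then show "UNIV - {r} \<noteq> {}" unfolding card_gt_0_iff by blast
  qed (auto simp: cut_singleton)
  with c assms have "edge_rank (UNIV - cut {r}) + 2 \<le> CARD('v)" by linarith
  then show ?thesis unfolding one_tree_rank_def by auto
qed

text \<open>The degree sum \<open>2 * card S\<close> counts the inside edges twice and the cut once,
  and the cut has weight at least 2.\<close>

lemma subtour_polytope_sum_inside:
  assumes x: "x \<in> subtour_polytope" and S: "S \<noteq> {}" "S \<noteq> UNIV"
  shows "edge_sum x {e\<in>K_edges. e \<subseteq> S} \<le> real (card S) - 1"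
proof -
  have "2 * real (card S) = (\<Sum>v\<in>S. edge_sum x (cut {v}))"
    using x by (simp add: subtour_polytope_def)
  also have "\<dots> = 2 * edge_sum x {e\<in>K_edges. e \<subseteq> S} + edge_sum x (cut S)"
    by (rule sum_cut_singletons)
  finally have "2 * real (card S) = 2 * edge_sum x {e\<in>K_edges. e \<subseteq> S} + edge_sum x (cut S)" .
  moreover have "edge_sum x (cut S) \<ge> 2"
    using x S by (auto simp: subtour_polytope_def)
  ultimately show ?thesis by simp
qed

lemma subtour_polytope_sum_total:
  fixes x :: "real ^ ('v::finite set)"
  assumes x: "x \<in> subtour_polytope"
  shows "edge_sum x K_edges = real CARD('v)"
proof -
  have "2 * real CARD('v) = (\<Sum>v\<in>UNIV. edge_sum x (cut {v}))"
    using x by (simp add: subtour_polytope_def)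
  also have "\<dots> = 2 * edge_sum x {e\<in>K_edges. e \<subseteq> UNIV} + edge_sum x (cut UNIV)"
    by (rule sum_cut_singletons)
  also have "cut UNIV = ({} :: 'v set set)" by (auto simp: cut_def K_edges_def)
  finally show ?thesis by (simp add: edge_sum_def)
qed

text \<open>The weight away from \<open>r\<close> is bounded through \<open>sum_le_edge_rank\<close>
  and the subtour constraints, the weight at \<open>r\<close> by the degree 2.\<close>

lemma subtour_polytope_in_base_polytope:
  fixes x :: "real ^ ('v::finite set)"
  assumes n: "CARD('v) \<ge> 2" and x: "x \<in> subtour_polytope"
  shows "x \<in> base_polytope (one_tree_rank r)"
proof -
  have off: "x $ e = 0" if "e \<notin> K_edges" for e
    using x that by (auto simp: subtour_polytope_def edge_space_def)
  then have nn: "x $ e \<ge> 0" for e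
    using x by (cases "e \<in> K_edges") (auto simp: subtour_polytope_def)
  have le: "sum (($) x) A \<le> of_int (one_tree_rank r A)" for A
  proof -
    let ?A = "A \<inter> K_edges - cut {r}"
    have "sum (($) x) A = sum (($) x) (A \<inter> K_edges)"
      by (rule sum.mono_neutral_right) (auto simp: off)
    also have "A \<inter> K_edges = ?A \<union> (A \<inter> cut {r})" by (auto simp: cut_def)
    also have "sum (($) x) \<dots> = sum (($) x) ?A + sum (($) x) (A \<inter> cut {r})"
      by (rule sum.union_disjoint) auto
    finally have split: "sum (($) x) A = sum (($) x) ?A + sum (($) x) (A \<inter> cut {r})" .
    have "sum (($) x) ?A \<le> real (edge_rank ?A)"
    proof (rule sum_le_edge_rank)
      fix S :: "'v set" assume S: "S \<noteq> {}"
      show "sum (($) x) {e\<in>?A. e \<subseteq> S} \<le> real (card S) - 1"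
      \<comment> \<open>The edges of \<open>?A\<close> avoid \<open>r\<close>, so \<open>S\<close>
        may be replaced by \<open>S - {r}\<close>. This set is never \<open>UNIV\<close>, hence a
        subtour constraint applies to it even for \<open>S = UNIV\<close>.\<close>
      proof (cases "S - {r} = {}")
        case True
        have "{e\<in>?A. e \<subseteq> S} = {}"
        proof (rule equals0I)
          fix e assume e: "e \<in> {e\<in>?A. e \<subseteq> S}"
          then obtain u v where "e = {u, v}" "u \<noteq> v" by (blast elim: K_edgesE)
          with e True show False by auto
        qed
        then have "sum (($) x) {e\<in>?A. e \<subseteq> S} = 0" by (simp only: sum.empty)
        moreover have "card S \<ge> 1" using S by (simp add: Suc_leI card_gt_0_iff)
        ultimately show ?thesis by simp
      next
        case False
        have "sum (($) x) {e\<in>?A. e \<subseteq> S} \<le> edge_sum x {e\<in>K_edges. e \<subseteq> S - {r}}"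
          unfolding edge_sum_def by (rule sum_mono2) (auto simp: cut_singleton nn)
        also have "\<dots> \<le> real (card (S - {r})) - 1"
          by (rule subtour_polytope_sum_inside[OF x False]) auto
        also have "\<dots> \<le> real (card S) - 1" by (simp add: card_mono)
        finally show ?thesis .
      qed
    qed auto
    moreover have "edge_rank ?A \<le> edge_rank (A - cut {r})" by (rule edge_rank_mono) auto
    moreover have "sum (($) x) (A \<inter> cut {r}) \<le> 2"
    proof -
      have "sum (($) x) (A \<inter> cut {r}) \<le> edge_sum x (cut {r})"
        unfolding edge_sum_def by (rule sum_mono2) (auto simp: nn)
      also have "\<dots> = 2" using x by (simp add: subtour_polytope_def)
      finally show ?thesis .
    qed
    ultimately show ?thesis unfolding split by (auto simp: one_tree_rank_def)
  qed
  have "sum (($) x) UNIV = sum (($) x) K_edges"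
    by (rule sum.mono_neutral_right) (auto simp: off)
  also have "\<dots> = real CARD('v)" using subtour_polytope_sum_total[OF x] by (simp add: edge_sum_def)
  finally have tot: "sum (($) x) UNIV = real CARD('v)" .
  \<comment> \<open>Since \<open>x\<close> has total weight \<open>CARD('v)\<close>, this upper
    bound turns the inequality for \<open>UNIV\<close> into the required equality.\<close>
  have "of_int (one_tree_rank r UNIV) \<le> real CARD('v)"
    using one_tree_rank_UNIV_le[OF n, of r] by (metis of_int_le_iff of_int_of_nat_eq)
  with le[of UNIV] tot le show ?thesis by (auto simp: base_polytope_def)
qed

text \<open>At most 2 edges lie at \<open>r\<close> and at most n - 2 elsewhere. A total of n edges
  makes both bounds equalities, and the counting criterion for spanning trees applies.\<close>

lemma one_tree_if_incidence_vector_in_base_polytope: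
  fixes F :: "'v::finite set set"
  assumes n: "CARD('v) \<ge> 2" and F: "F \<subseteq> K_edges" and card: "card F = CARD('v)"
    and base: "\<And>A. int (card (F \<inter> A)) \<le> one_tree_rank r A"
  shows "one_tree r F"
proof -
  let ?W = "UNIV - {r}"
  have cW: "card ?W = CARD('v) - 1" by (simp add: card_Diff_singleton)
  then have "card ?W > 0" using n by linarith
  then have W: "?W \<noteq> {}" unfolding card_gt_0_iff by blast
  have inside: "card {e\<in>F. e \<subseteq> S} < card S" if "S \<noteq> {}" "S \<subseteq> ?W" for S
  proof -
    have "{e\<in>F. e \<subseteq> S} = F \<inter> {e\<in>K_edges. e \<subseteq> S}" using F by auto
    then have "int (card {e\<in>F. e \<subseteq> S}) \<le> one_tree_rank r {e\<in>K_edges. e \<subseteq> S}"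
      using base by simp
    also have "\<dots> < int (card S)" by (rule one_tree_rank_inside) (use that in auto)
    finally show ?thesis by simp
  qed
  have sub: "F - cut {r} = {e\<in>F. e \<subseteq> ?W}" using F by (auto simp: cut_singleton)
  have c1: "card (F \<inter> cut {r}) \<le> 2" using base[of "cut {r}"] one_tree_rank_cut[of r] by linarith
  have c2: "card (F - cut {r}) < card ?W" unfolding sub by (rule inside) (use W in auto)
  have "card F = card (F \<inter> cut {r}) + card (F - cut {r})"
    by (metis card_Int_Diff finite)
  with c1 c2 card cW n have eq: "card (F \<inter> cut {r}) = 2" "card (F - cut {r}) + 1 = card ?W" by linarith+
  have "spanning_tree_on ?W (F - cut {r})"
  proof (rule spanning_tree_onI)
    show "F - cut {r} \<subseteq> {e\<in>K_edges. e \<subseteq> ?W}" using F sub by auto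
    fix S assume S: "S \<noteq> {}" "S \<subseteq> ?W"
    have "card {e\<in>F - cut {r}. e \<subseteq> S} \<le> card {e\<in>F. e \<subseteq> S}" by (rule card_mono) auto
    with inside[OF S] show "card {e\<in>F - cut {r}. e \<subseteq> S} < card S" by simp
  qed (use W eq in auto)
  with F eq show ?thesis by (simp add: one_tree_def)
qed

section \<open>Convex combinations of 1-trees respecting the pairs\<close>

theorem theorem6:
  fixes r :: "'v::finite"
    and x :: "real ^ ('v set)"
    and P :: "'v set set set"
  assumes "CARD('v) \<ge> 3"
    and "x \<in> subtour_polytope"
    and "half_integer x"
    and "partition_on (half_edges x) P"
    and "\<forall>p\<in>P. card p = 2"
  shows "x \<in> convex hull {incidence_vector F | F.
           one_tree r F \<and> (\<forall>p\<in>P. card (F \<inter> p) = 1)}"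
proof -
  have n: "CARD('v) \<ge> 2" using assms(1) by simp
  have off: "x $ e = 0" if "e \<notin> K_edges" for e
    using assms(2) that by (auto simp: subtour_polytope_def edge_space_def)
  have x01: "x $ e \<in> {0, 1/2, 1}" for e
    using off assms(3) by (cases "e \<in> K_edges") (auto simp: half_integer_def)
  have half: "e \<in> half_edges x \<longleftrightarrow> x $ e = 1/2" for e
    using off[of e] by (cases "e \<in> K_edges") (auto simp: half_edges_def)
  \<comment> \<open>The fibres of \<open>d\<close> are the pairs in \<open>P\<close> and the singletons of the remaining coordinates.\<close>
  define d where "d e = insert e (\<Union>{p\<in>P. e \<in> p})" for e
  have d_in: "d e = p" if "p \<in> P" "e \<in> p" for e p
  proof -
    have "{q\<in>P. e \<in> q} = {p}"
      using that partition_onD2[OF assms(4)] by (auto simp: disjoint_def)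
    with that show ?thesis by (auto simp: d_def)
  qed
  have d_out: "d e = {e}" if "e \<notin> half_edges x" for e
    using that partition_onD1[OF assms(4)] by (auto simp: d_def)
  have self: "e \<in> d e" for e by (simp add: d_def)
  have fib_in: "{e. d e = p} = p" if "p \<in> P" for p
    using d_in self that by auto
  have fib_out: "{e'. d e' = {e}} = {e}" if "e \<notin> half_edges x" for e
    using d_out[OF that] self by auto
  have sum_in: "sum (($) x) p = 1" if "p \<in> P" for p
  proof -
    have "sum (($) x) p = (\<Sum>e\<in>p. 1/2)"
      using partition_onD1[OF assms(4)] that half by (intro sum.cong) auto
    also have "\<dots> = 1" using assms(5) that by simp
    finally show ?thesis .
  qed
  have "sum (($) x) {e. d e = k} \<in> \<int>" for k
  proof (cases "\<exists>e. d e = k")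
    case True
    then obtain e where e: "d e = k" by blast
    show ?thesis
    proof (cases "e \<in> half_edges x")
      case True
      then obtain p where p: "p \<in> P" "e \<in> p" using partition_onD1[OF assms(4)] by blast
      with e have "k = p" using d_in by blast
      with p show ?thesis using fib_in sum_in by simp
    next
      case False
      with e have "k = {e}" using d_out by blast
      then show ?thesis using fib_out[OF False] False x01[of e] half by auto
    qed
  next
    case False
    then have "{e. d e = k} = {}" by blast
    then show ?thesis by (simp only: sum.empty Ints_0)
  qed
  then have "x \<in> convex hull {y \<in> base_polytope (one_tree_rank r). (\<forall>e. y $ e \<in> {0, 1}) \<and>
           (\<forall>k. sum (($) y) {e. d e = k} = sum (($) x) {e. d e = k})}"
  proof (intro base_polytope_in_hull_of_integral_fibres submodular_one_tree_rank
      one_tree_rank_empty subtour_polytope_in_base_polytope n assms(2))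
    show "x $ e \<in> {0..1}" for e using x01[of e] by auto
  qed
  \<comment> \<open>Each 0/1 point is the incidence vector of its support \<open>F\<close>, and the
    fibre equations translate into the conditions on \<open>F\<close>.\<close>
  moreover have "{y \<in> base_polytope (one_tree_rank r). (\<forall>e. y $ e \<in> {0, 1}) \<and>
           (\<forall>k. sum (($) y) {e. d e = k} = sum (($) x) {e. d e = k})}
    \<subseteq> {incidence_vector F | F. one_tree r F \<and> (\<forall>p\<in>P. card (F \<inter> p) = 1)}"
  proof
    fix y assume "y \<in> {y \<in> base_polytope (one_tree_rank r). (\<forall>e. y $ e \<in> {0, 1}) \<and>
           (\<forall>k. sum (($) y) {e. d e = k} = sum (($) x) {e. d e = k})}"
    then have yB: "y \<in> base_polytope (one_tree_rank r)" and y01: "\<And>e. y $ e \<in> {0, 1}"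
      and fib: "\<And>k. sum (($) y) {e. d e = k} = sum (($) x) {e. d e = k}" by auto
    define F where "F = {e. y $ e = 1}"
    have yF: "y $ e = (if e \<in> F then 1 else 0)" for e
      using y01[of e] by (auto simp: F_def)
    have sumF: "sum (($) y) A = real (card (F \<inter> A))" for A
      by (simp add: yF sum.If_cases Int_commute)
    have "F \<subseteq> K_edges"
    proof
      fix e assume "e \<in> F"
      show "e \<in> K_edges"
      proof (rule ccontr)
        assume "e \<notin> K_edges"
        then have "e \<notin> half_edges x" "x $ e = 0" using off by (auto simp: half_edges_def)
        \<comment> \<open>The fibre of a non-edge is a singleton, so \<open>y\<close> inherits the
          value 0 from \<open>x\<close> there.\<close>
        with fib[of "{e}"] fib_out[of e] \<open>e \<in> F\<close> show False by (simp add: F_def)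
      qed
    qed
    moreover have base: "int (card (F \<inter> A)) \<le> one_tree_rank r A" for A
    proof -
      have "real (card (F \<inter> A)) \<le> of_int (one_tree_rank r A)"
        unfolding sumF[symmetric] using yB by (simp add: base_polytope_def)
      then show ?thesis by linarith
    qed
    moreover have "card F = CARD('v)"
    proof -
      have "x \<in> base_polytope (one_tree_rank r)"
        by (rule subtour_polytope_in_base_polytope[OF n assms(2)])
      then have "sum (($) y) UNIV = sum (($) x) UNIV"
        using yB by (simp add: base_polytope_def)
      also have "\<dots> = edge_sum x K_edges"
        unfolding edge_sum_def by (rule sum.mono_neutral_right) (auto simp: off)
      also have "\<dots> = real CARD('v)" by (rule subtour_polytope_sum_total[OF assms(2)])
      finally show ?thesis using sumF[of UNIV] by simp
    qed
    ultimately have "one_tree r F"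
      by (intro one_tree_if_incidence_vector_in_base_polytope[OF n]) auto
    \<comment> \<open>The pair \<open>p\<close> is a fibre of \<open>d\<close> on which
      \<open>x\<close> sums to 1/2 + 1/2, so \<open>y\<close> also sums to 1 on it.\<close>
    moreover have "card (F \<inter> p) = 1" if "p \<in> P" for p
      using fib[of p] fib_in[OF that] sum_in[OF that] sumF[of p] by simp
    moreover have "y = incidence_vector F"
      by (simp add: vec_eq_iff incidence_vector_def yF)
    ultimately show "y \<in> {incidence_vector F | F. one_tree r F \<and> (\<forall>p\<in>P. card (F \<inter> p) = 1)}"
      by blast
  qed
  ultimately show ?thesis using hull_mono by blast
qed

end
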